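(* Let $M$ and $N$ be two weighted means (of the same direction), and let $I\subseteq(0,\infty)$ and $J\subseteq(0,\infty)$ be intervals. If the functions $f,g:I\to J$ are $MN$-convex, then the function $x\mapsto N(f(x),g(x),1/2)$ on $I$ is $MN$-convex.
   Context: A function $M:(0,\infty)\times(0,\infty)\times[0,1]\to(0,\infty)$ is called a weighted mean if the following hold. (WM1) $M(u,v,\lambda)=M(v,u,1-\lambda)$. (WM2) $M(u,u,\lambda)=u$. (WM3) $u<M(u,v,\lambda)<v$ whenever $u<v$ and $\lambda\in(0,1)$. (WM4) $M(\alpha u,\alpha v,\lambda)=\alpha M(u,v,\lambda)$ for all $\alpha>0$. (WM5) For fixed $\lambda\in[0,1]$: $M(u,v,\lambda)\le M(w,v,\lambda)$ whenever $u\le w$, and $M(u,v,\lambda)\le M(u,w,\lambda)$ whenever $v\le w$. (WM6) For fixed $u\ne v$, $M(u,v,\cdot)$ is strictly monotone and continuous on $[0,1]$ with range $[\min\{u,v\},\max\{u,v\}]$. Moreover $M$ has a direction: either $M(u,v,\cdot)$ is strictly increasing for all $u<v$ (positive direction; then $M(u,v,0)=u$, $M(u,v,1)=v$ for all $u,v$), or $M(u,v,\cdot)$ is strictly decreasing for all $u<v$ (negative direction; then $M(u,v,0)=v$, $M(u,v,1)=u$ for all $u,v$). (WM7) $M(M(u,v,\lambda),M(z,w,\lambda),s)=M(M(u,z,s),M(v,w,s),\lambda)$ for all $u,v,z,w>0$, $s,\lambda\in[0,1]$. (WM8) For all $u,v>0$, $s,\lambda_1,\lambda_2\in[0,1]$: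 $M(M(u,v,\lambda_1),M(u,v,\lambda_2),s)$ equals $M(u,v,s\lambda_1+(1-s)\lambda_2)$ if $M$ has negative direction, and $M(u,v,(1-s)\lambda_1+s\lambda_2)$ if $M$ has positive direction. Standing assumption: all weighted means occurring together have the same direction. For weighted means $M,N$ and intervals $I,J\subseteq(0,\infty)$, a function $f:I\to J$ is $MN$-convex if $f(M(u,v,\lambda))\le N(f(u),f(v),\lambda)$ for all $u,v\in I$, $\lambda\in[0,1]$. *)

theory Defs
  imports "HOL-Analysis.Analysis"
begin

text \<open>
  A function on \<open>(0,\<infinity>) \<times> (0,\<infinity>) \<times> [0,1]\<close> is represented by a total
  function of type \<open>real \<Rightarrow> real \<Rightarrow> real \<Rightarrow> real\<close>; nothing is required of its values
  outside that domain.
\<close>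

definition positive_direction :: "(real \<Rightarrow> real \<Rightarrow> real \<Rightarrow> real) \<Rightarrow> bool" where
  "positive_direction M \<longleftrightarrow> (\<forall>u v. 0 < u \<and> u < v \<longrightarrow> strict_mono_on {0..1} (M u v))"

definition negative_direction :: "(real \<Rightarrow> real \<Rightarrow> real \<Rightarrow> real) \<Rightarrow> bool" where
  "negative_direction M \<longleftrightarrow> (\<forall>u v. 0 < u \<and> u < v \<longrightarrow> strict_antimono_on {0..1} (M u v))"

definition same_direction ::
  "(real \<Rightarrow> real \<Rightarrow> real \<Rightarrow> real) \<Rightarrow> (real \<Rightarrow> real \<Rightarrow> real \<Rightarrow> real) \<Rightarrow> bool" where
  "same_direction M N \<longleftrightarrow>
     (positive_direction M \<and> positive_direction N) \<or>
     (negative_direction M \<and> negative_direction N)"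

locale weighted_mean =
  fixes M :: "real \<Rightarrow> real \<Rightarrow> real \<Rightarrow> real"
  assumes pos: "\<lbrakk>u > 0; v > 0; t \<in> {0..1}\<rbrakk> \<Longrightarrow> M u v t > 0"
    and WM1: "\<lbrakk>u > 0; v > 0; t \<in> {0..1}\<rbrakk> \<Longrightarrow> M u v t = M v u (1 - t)"
    and WM2: "\<lbrakk>u > 0; t \<in> {0..1}\<rbrakk> \<Longrightarrow> M u u t = u"
    and WM3: "\<lbrakk>u > 0; u < v; t \<in> {0<..<1}\<rbrakk> \<Longrightarrow> u < M u v t \<and> M u v t < v"
    and WM4: "\<lbrakk>u > 0; v > 0; a > 0; t \<in> {0..1}\<rbrakk> \<Longrightarrow> M (a * u) (a * v) t = a * M u v t"
    and WM5_left: "\<lbrakk>u > 0; v > 0; w > 0; t \<in> {0..1}; u \<le> w\<rbrakk> \<Longrightarrow> M u v t \<le> M w v t"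
    and WM5_right: "\<lbrakk>u > 0; v > 0; w > 0; t \<in> {0..1}; v \<le> w\<rbrakk> \<Longrightarrow> M u v t \<le> M u w t"
    and WM6_strict_monotone: "\<lbrakk>u > 0; v > 0; u \<noteq> v\<rbrakk> \<Longrightarrow>
          strict_mono_on {0..1} (M u v) \<or> strict_antimono_on {0..1} (M u v)"
    and WM6_continuous: "\<lbrakk>u > 0; v > 0; u \<noteq> v\<rbrakk> \<Longrightarrow> continuous_on {0..1} (M u v)"
    and WM6_range: "\<lbrakk>u > 0; v > 0; u \<noteq> v\<rbrakk> \<Longrightarrow> M u v ` {0..1} = {min u v..max u v}"
    and WM6_direction: "positive_direction M \<or> negative_direction M"
    and WM6_positive: "\<lbrakk>positive_direction M; u > 0; v > 0\<rbrakk> \<Longrightarrow> M u v 0 = u \<and> M u v 1 = v"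
    and WM6_negative: "\<lbrakk>negative_direction M; u > 0; v > 0\<rbrakk> \<Longrightarrow> M u v 0 = v \<and> M u v 1 = u"
    and WM7: "\<lbrakk>u > 0; v > 0; z > 0; w > 0; s \<in> {0..1}; t \<in> {0..1}\<rbrakk> \<Longrightarrow>
          M (M u v t) (M z w t) s = M (M u z s) (M v w s) t"
    and WM8_negative: "\<lbrakk>negative_direction M; u > 0; v > 0; s \<in> {0..1}; t1 \<in> {0..1}; t2 \<in> {0..1}\<rbrakk> \<Longrightarrow>
          M (M u v t1) (M u v t2) s = M u v (s * t1 + (1 - s) * t2)"
    and WM8_positive: "\<lbrakk>positive_direction M; u > 0; v > 0; s \<in> {0..1}; t1 \<in> {0..1}; t2 \<in> {0..1}\<rbrakk> \<Longrightarrow>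
          M (M u v t1) (M u v t2) s = M u v ((1 - s) * t1 + s * t2)"

definition MN_convex ::
  "(real \<Rightarrow> real \<Rightarrow> real \<Rightarrow> real) \<Rightarrow> (real \<Rightarrow> real \<Rightarrow> real \<Rightarrow> real) \<Rightarrow>
   real set \<Rightarrow> real set \<Rightarrow> (real \<Rightarrow> real) \<Rightarrow> bool" where
  "MN_convex M N I J f \<longleftrightarrow>
     f \<in> I \<rightarrow> J \<and>
     (\<forall>u\<in>I. \<forall>v\<in>I. \<forall>t\<in>{0..1}. f (M u v t) \<le> N (f u) (f v) t)"

end

theory Submission
  imports Defs
begin

text \<open>
  Convexity of \<open>f\<close> and \<open>g\<close>, monotonicity of \<open>N\<close> in both arguments, and the interchange
  law (WM7), which swaps the inner weight \<open>t\<close> with the outer weight \<open>1/2\<close>.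
\<close>

context weighted_mean
begin

text \<open>By (WM6) the mean lies between \<open>min u v\<close> and \<open>max u v\<close>, which
  both belong to \<open>I\<close>; (WM6) covers distinct arguments only, so \<open>u = v\<close>
  falls to (WM2). The lemma serves twice: for \<open>M\<close> on \<open>I\<close> and for
  \<open>N\<close> on \<open>J\<close>.\<close>

lemma mean_mem_interval:
  assumes "is_interval I" "I \<subseteq> {0<..}" "u \<in> I" "v \<in> I" "t \<in> {0..1}"
  shows "M u v t \<in> I"
proof -
  have "u > 0" "v > 0"
    using assms by auto
  then have "M u v t \<in> {min u v..max u v}"
    using WM2[of u t] WM6_range[of u v] assms(5) by (cases "u = v") auto
  moreover have "min u v \<in> I" "max u v \<in> I"
    using assms(3,4) by (simp_all add: min_def max_def)
  ultimately show ?thesis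
    using assms(1) by (meson atLeastAtMost_iff mem_is_interval_1_I)
qed

text \<open>(WM5) is applied to one argument at a time, through the intermediate value
  \<open>M u' v t\<close>.\<close>

lemma mean_mono:
  assumes "u > 0" "v > 0" "u \<le> u'" "v \<le> v'" "t \<in> {0..1}"
  shows "M u v t \<le> M u' v' t"
proof -
  have "M u v t \<le> M u' v t"
    using assms by (intro WM5_left) auto
  also have "\<dots> \<le> M u' v' t"
    using assms by (intro WM5_right) auto
  finally show ?thesis .
qed

end

theorem theorem2:
  fixes M N :: "real \<Rightarrow> real \<Rightarrow> real \<Rightarrow> real" and I J :: "real set" and f g :: "real \<Rightarrow> real"
  assumes "weighted_mean M" and "weighted_mean N" and "same_direction M N"
    and "is_interval I" and "I \<subseteq> {0<..}"
    and "is_interval J" and "J \<subseteq> {0<..}"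
    and "MN_convex M N I J f" and "MN_convex M N I J g"
  shows "MN_convex M N I J (\<lambda>x. N (f x) (g x) (1 / 2))"
proof -
  interpret M: weighted_mean M by fact
  interpret N: weighted_mean N by fact
  have J: "f x \<in> J" "g x \<in> J" if "x \<in> I" for x
    using assms(8,9) that by (auto simp: MN_convex_def)
  then have pos: "f x > 0" "g x > 0" if "x \<in> I" for x
    using assms(7) that by auto
  have "N (f (M u v t)) (g (M u v t)) (1/2) \<le> N (N (f u) (g u) (1/2)) (N (f v) (g v) (1/2)) t"
    if uv: "u \<in> I" "v \<in> I" and t: "t \<in> {0..1}" for u v t
  proof -
    have "M u v t \<in> I"
      using M.mean_mem_interval assms(4,5) uv t by blast
    moreover have "f (M u v t) \<le> N (f u) (f v) t" "g (M u v t) \<le> N (g u) (g v) t"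
      using assms(8,9) uv t by (auto simp: MN_convex_def)
    \<comment> \<open>Monotonicity requires the smaller arguments \<open>f (M u v t)\<close> and
      \<open>g (M u v t)\<close> to be positive; this is where \<open>M u v t \<in> I\<close>
      enters.\<close>
    ultimately have "N (f (M u v t)) (g (M u v t)) (1/2) \<le> N (N (f u) (f v) t) (N (g u) (g v) t) (1/2)"
      using pos by (intro N.mean_mono) auto
    also have "\<dots> = N (N (f u) (g u) (1/2)) (N (f v) (g v) (1/2)) t"
      using pos uv t by (intro N.WM7) auto
    finally show ?thesis .
  qed
  \<comment> \<open>\<open>MN_convex\<close> also demands that the new function map \<open>I\<close>
    into \<open>J\<close>; an interval of positive reals is closed under \<open>N\<close>.\<close>
  moreover have "N (f x) (g x) (1/2) \<in> J" if "x \<in> I" for x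
    using N.mean_mem_interval[OF assms(6,7) J(1)[OF that] J(2)[OF that]] by simp
  ultimately show ?thesis
    by (auto simp: MN_convex_def)
qed

end
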